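(* In the screening model described in the context, suppose the conditions of limited feasible recourse ($\bar r<a_L/\delta$ and $K_L(\bar r)<v$) and acceptance dominance at the top ($q_H(r)(a_H+\delta r)\le a_H$ for every $r\in\mathcal R$) hold, so that the tie-broken optimal rule is a threshold rule with cutoffs $\underline p<p^A<\bar p$. Then, relative to the no-recourse benchmark, $$W^1(p)=W^0(p)\quad\text{for }p\in[0,\underline p)\cup[\bar p,1],$$ $$W^1(p)>W^0(p)=0\quad\text{for }p\in[\underline p,p^A),$$ $$W^1(p)<W^0(p)=v\quad\text{for }p\in[p^A,\bar p).$$
   Context: Primitives: real numbers $a_H>0$, $a_L>0$, $v>0$, $\delta>0$, $\bar\varepsilon>0$; a compact interval $\mathcal R=[\underline r,\bar r]$ with $0<\underline r\le\bar r$; for each type $\theta\in\{H,L\}$ a twice differentiable function $K_\theta:\mathcal R\to\mathbb R$ with $K_\theta\ge 0$, $K_\theta'>0$, $K_\theta''\ge 0$ on $\mathcal R$ (derivatives one-sided at endpoints), and $K_H(r)\le K_L(r)$ for all $r\in\mathcal R$. Completion probabilities (the probability that $K_\theta(r)+\varepsilon\le v$ when $\varepsilon$ is uniform on $[0,\bar\varepsilon]$): $$q_\theta(r)=\min\left\{\max\left\{\frac{v-K_\theta(r)}{\bar\varepsilon},0\right\},1\right\}.$$ At posterior belief $p\in[0,1]$ (the probability that the applicant is of type $H$), the principal chooses one of: accept ($A$), reject ($R$), or offer recourse with some requirement $r\in\mathcal R$ ($(O,r)$). The payoffs are $$U^A(p)=pa_H-(1-p)a_L,\qquad U^R=0,\qquad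 U^O(p,r)=p\,q_H(r)(a_H+\delta r)+(1-p)\,q_L(r)(-a_L+\delta r).$$ Let $V^O(p)=\max_{r\in\mathcal R}U^O(p,r)$. Tie-broken optimal action at $p$: accept if $U^A(p)\ge\max\{0,V^O(p)\}$; otherwise offer recourse with a requirement $r^*(p)\in\arg\max_{r\in\mathcal R}U^O(p,r)$ if $V^O(p)\ge 0$; otherwise reject. Cutoffs: let $p^A=a_L/(a_H+a_L)$. Under limited feasible recourse and acceptance dominance at the top, there are unique numbers $0<\underline p<p^A<\bar p\le1$ such that the tie-broken optimal action is rejection exactly on $[0,\underline p)$, recourse exactly on $[\underline p,\bar p)$, and acceptance exactly on $[\bar p,1]$. Applicant welfare: an applicant gets $v$ if accepted outright and $0$ if rejected. In the no-recourse benchmark the principal accepts iff $p\ge p^A$ and otherwise rejects, so $W^0(p)=0$ for $p<p^A$ and $W^0(p)=v$ for $p\ge p^A$. A type-$\theta$ applicant offered recourse with requirement $r$ has expected payoff $B_\theta(r)=\mathbb E_\varepsilon[\max\{v-K_\theta(r)-\varepsilon,0\}]$ with $\varepsilon\sim\mathrm{Unif}[0,\bar\varepsilon]$, and $B(p,r)=pB_H(r)+(1-p)B_L(r)$. $W^1(p)$ is applicant welfare under the tie-broken optimal rule with recourse available: $W^1(p)=0$ where the rule rejects, $W^1(p)=v$ where it accepts, and $W^1(p)=B(p,r^*(p))$ where it offers recourse (for any choice of maximizer $r^*(p)$). *)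

theory Defs
  imports "HOL-Probability.Probability"
begin

datatype applicant_type = H | L

record screening =
  gain :: real                                  (* a_H *)
  loss :: real                                  (* a_L *)
  val :: real                                   (* v *)
  bonus :: real                                 (* delta *)
  shock_max :: real                             (* upper end of the cost-shock support *)
  req_lo :: real
  req_hi :: real
  cost :: "applicant_type \<Rightarrow> real \<Rightarrow> real"     (* K_H and K_L *)

definition requirements :: "screening \<Rightarrow> real set" where
  "requirements M = {req_lo M..req_hi M}"

text \<open>The cost functions matter only on the requirement interval. Derivatives are taken within that
  interval, hence one-sided at its endpoints.\<close>

definition screening_model :: "screening \<Rightarrow> bool" where
  "screening_model M \<longleftrightarrow>
     gain M > 0 \<and> loss M > 0 \<and> val M > 0 \<and> bonus M > 0 \<and> shock_max M > 0 \<and>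
     0 < req_lo M \<and> req_lo M \<le> req_hi M \<and>
     (\<forall>\<theta>. \<exists>K' K''. \<forall>r\<in>requirements M.
        (cost M \<theta> has_real_derivative K' r) (at r within requirements M) \<and>
        (K' has_real_derivative K'' r) (at r within requirements M) \<and>
        cost M \<theta> r \<ge> 0 \<and> K' r > 0 \<and> K'' r \<ge> 0) \<and>
     (\<forall>r\<in>requirements M. cost M H r \<le> cost M L r)"

text \<open>The probability that the cost plus a shock uniform on the interval from 0 to the shock bound does
  not exceed the value of acceptance, in closed form.\<close>

definition completion_prob :: "screening \<Rightarrow> applicant_type \<Rightarrow> real \<Rightarrow> real" where
  "completion_prob M \<theta> r = min (max ((val M - cost M \<theta> r) / shock_max M) 0) 1"

definition accept_payoff :: "screening \<Rightarrow> real \<Rightarrow> real" where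
  "accept_payoff M p = p * gain M - (1 - p) * loss M"

definition offer_payoff :: "screening \<Rightarrow> real \<Rightarrow> real \<Rightarrow> real" where
  "offer_payoff M p r =
     p * completion_prob M H r * (gain M + bonus M * r) +
     (1 - p) * completion_prob M L r * (- loss M + bonus M * r)"

text \<open>The supremum below is a maximum, by the lemma that follows.\<close>

definition offer_value :: "screening \<Rightarrow> real \<Rightarrow> real" where
  "offer_value M p = (SUP r\<in>requirements M. offer_payoff M p r)"

lemma offer_value_attained:
  assumes "screening_model M"
  shows "\<exists>r. is_arg_max (offer_payoff M p) (\<lambda>r. r \<in> requirements M) r \<and>
             offer_payoff M p r = offer_value M p"
proof -
  let ?R = "requirements M"
  have "compact ?R" "?R \<noteq> {}"
    using assms by (auto simp: requirements_def screening_model_def)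
  have K: "continuous_on ?R (cost M \<theta>)" for \<theta>
    using assms unfolding screening_model_def by (meson DERIV_continuous_on)
  have "shock_max M \<noteq> 0"
    using assms by (simp add: screening_model_def)
  then have "continuous_on ?R (offer_payoff M p)"
    unfolding offer_payoff_def completion_prob_def by (intro continuous_intros K) auto
  then obtain r where r: "r \<in> ?R" "\<forall>s\<in>?R. offer_payoff M p s \<le> offer_payoff M p r"
    using continuous_attains_sup[OF \<open>compact ?R\<close> \<open>?R \<noteq> {}\<close>] by blast
  then have "offer_value M p = offer_payoff M p r"
    unfolding offer_value_def by (intro cSup_eq_maximum) auto
  with r show ?thesis
    by (intro exI[of _ r]) (auto simp: is_arg_max_def not_less)
qed

datatype decision = Accept | Recourse | Reject

text \<open>Ties favour acceptance over recourse and recourse over rejection (payoff 0).\<close>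

definition optimal_decision :: "screening \<Rightarrow> real \<Rightarrow> decision" where
  "optimal_decision M p =
     (if accept_payoff M p \<ge> max 0 (offer_value M p) then Accept
      else if offer_value M p \<ge> 0 then Recourse
      else Reject)"

text \<open>A choice of maximising requirement at every belief at which recourse is offered.\<close>

definition optimal_requirement :: "screening \<Rightarrow> (real \<Rightarrow> real) \<Rightarrow> bool" where
  "optimal_requirement M rs \<longleftrightarrow>
     (\<forall>p\<in>{0..1}. optimal_decision M p = Recourse \<longrightarrow>
        is_arg_max (offer_payoff M p) (\<lambda>r. r \<in> requirements M) (rs p))"

definition accept_cutoff :: "screening \<Rightarrow> real" where
  "accept_cutoff M = loss M / (gain M + loss M)"

definition threshold_cutoffs :: "screening \<Rightarrow> real \<Rightarrow> real \<Rightarrow> bool" where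
  "threshold_cutoffs M pl ph \<longleftrightarrow>
     0 < pl \<and> pl < accept_cutoff M \<and> accept_cutoff M < ph \<and> ph \<le> 1 \<and>
     {p\<in>{0..1}. optimal_decision M p = Reject} = {0..<pl} \<and>
     {p\<in>{0..1}. optimal_decision M p = Recourse} = {pl..<ph} \<and>
     {p\<in>{0..1}. optimal_decision M p = Accept} = {ph..1}"

definition limited_feasible_recourse :: "screening \<Rightarrow> bool" where
  "limited_feasible_recourse M \<longleftrightarrow>
     req_hi M < loss M / bonus M \<and> cost M L (req_hi M) < val M"

definition acceptance_dominance_at_top :: "screening \<Rightarrow> bool" where
  "acceptance_dominance_at_top M \<longleftrightarrow>
     (\<forall>r\<in>requirements M. completion_prob M H r * (gain M + bonus M * r) \<le> gain M)"

definition benchmark_welfare :: "screening \<Rightarrow> real \<Rightarrow> real" where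
  "benchmark_welfare M p = (if p \<ge> accept_cutoff M then val M else 0)"

definition type_recourse_benefit :: "screening \<Rightarrow> applicant_type \<Rightarrow> real \<Rightarrow> real" where
  "type_recourse_benefit M \<theta> r =
     (\<integral>e. max (val M - cost M \<theta> r - e) 0 \<partial>uniform_measure lborel {0..shock_max M})"

definition recourse_benefit :: "screening \<Rightarrow> real \<Rightarrow> real \<Rightarrow> real" where
  "recourse_benefit M p r =
     p * type_recourse_benefit M H r + (1 - p) * type_recourse_benefit M L r"

definition recourse_welfare :: "screening \<Rightarrow> (real \<Rightarrow> real) \<Rightarrow> real \<Rightarrow> real" where
  "recourse_welfare M rs p =
     (case optimal_decision M p of
        Accept \<Rightarrow> val M
      | Recourse \<Rightarrow> recourse_benefit M p (rs p)
      | Reject \<Rightarrow> 0)"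

end

theory Submission
  imports Defs
begin

text \<open>For a fixed requirement, the offer payoff is affine in the belief, strictly increasing by limited
  feasible recourse, and it grows strictly slower than the acceptance payoff because recourse is
  dominated at the top and \<open>q\<^sub>L(r) (a\<^sub>L - \<delta> r) < a\<^sub>L\<close>. Both properties survive the maximum
  over requirements, so the value of recourse and its shortfall against acceptance each cross zero
  exactly once. At \<open>p\<^sup>A\<close> acceptance is worth 0 while recourse is worth more, since \<open>q\<^sub>H \<ge> q\<^sub>L\<close>
  and \<open>\<delta> r > 0\<close>; this
  puts \<open>p\<^sup>A\<close> strictly between the two crossings. Finally, an offered applicant of either type expects
  strictly more than 0 and strictly less than \<open>v\<close>.\<close>

section \<open>Two analytic tools: a mean under a uniform shock, and zero crossings\<close>

lemma uniform_expected_excess_bounds: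
  fixes c s :: real
  assumes "c > 0" "s > 0"
  shows "(\<integral>e. max (c - e) 0 \<partial>uniform_measure lborel {0..s}) > 0"
    and "(\<integral>e. max (c - e) 0 \<partial>uniform_measure lborel {0..s}) < c"
proof -
  let ?U = "uniform_measure lborel {0..s}"
  interpret prob_space ?U
    using assms by (intro prob_space_uniform_measure) auto
  have AE_iff: "(AE e in ?U. P e) \<longleftrightarrow> (AE e in lborel. e \<in> {0..s} \<longrightarrow> P e)"
    if "Measurable.pred lborel P" for P
    using that assms by (intro AE_uniform_measure) auto
  have int: "integrable ?U (\<lambda>e. max (c - e) 0)"
    using assms by (intro integrable_const_bound[where B=c]) (auto simp: AE_iff)
  \<comment> \<open>The integrand equals \<open>c\<close> at \<open>e = 0\<close>, so strictness
    holds only after removing this null point.\<close>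
  have "AE e in ?U. max (c - e) 0 < c"
    using AE_lborel_singleton[of 0] by (auto simp: AE_iff assms elim!: eventually_mono)
  with int show "(\<integral>e. max (c - e) 0 \<partial>?U) < c"
    by (rule expectation_less)
  have "(\<integral>e. max (c - e) 0 \<partial>?U) \<noteq> 0"
  proof
    assume "(\<integral>e. max (c - e) 0 \<partial>?U) = 0"
    then have "AE e in ?U. max (c - e) 0 = 0"
      using integral_nonneg_eq_0_iff_AE[OF int] by simp
    \<comment> \<open>Up to \<open>min s (c / 2)\<close> the excess is at least
      \<open>c / 2\<close>, so an integrand vanishing almost everywhere would make this interval
      null, although its length is positive.\<close>
    then have "AE e in lborel. e \<notin> {0..min s (c / 2)}"
      using assms by (auto simp: AE_iff elim!: eventually_mono)
    then have "emeasure lborel {0..min s (c / 2)} = 0"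
      by (subst (asm) AE_iff_measurable[of "{0..min s (c / 2)}"]) auto
    then show False
      using assms by (auto simp: min_def split: if_splits)
  qed
  moreover have "(\<integral>e. max (c - e) 0 \<partial>?U) \<ge> 0"
    by (rule integral_nonneg_AE) simp
  ultimately show "(\<integral>e. max (c - e) 0 \<partial>?U) > 0"
    by linarith
qed

text \<open>The intermediate value theorem supplies the zero. Monotonicity is assumed on the whole
  line, so the sign rule holds for every \<open>x\<close> and not just between \<open>a\<close> and
  \<open>b\<close>.\<close>

lemma strict_increasing_crossing:
  fixes f :: "real \<Rightarrow> real"
  assumes "a < b" "continuous_on {a..b} f" "f a < 0" "f b \<ge> 0"
    and mono: "\<And>x y. x < y \<Longrightarrow> f x < f y"
  obtains c where "a < c" "c \<le> b" "f c = 0" "\<And>x. f x \<ge> 0 \<longleftrightarrow> c \<le> x"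
proof -
  obtain c where c: "a \<le> c" "c \<le> b" "f c = 0"
    using IVT'[of f a 0 b] assms by auto
  with \<open>f a < 0\<close> have "a < c"
    by (cases "a = c") auto
  moreover have "f x \<ge> 0 \<longleftrightarrow> c \<le> x" for x
    using mono[of x c] mono[of c x] c(3) by (cases x c rule: linorder_cases) auto
  ultimately show thesis
    using c that[of c] by blast
qed

section \<open>Bounds on costs, completion probabilities and bonuses\<close>

locale screening_setting =
  fixes M :: screening
  assumes model: "screening_model M"
    and limited: "limited_feasible_recourse M"
    and top: "acceptance_dominance_at_top M"
begin

abbreviation "\<R> \<equiv> requirements M"
abbreviation "q \<equiv> completion_prob M"

lemma positive: "gain M > 0" "loss M > 0" "val M > 0" "bonus M > 0" "shock_max M > 0"
  using model by (simp_all add: screening_model_def)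

lemma accept_cutoff_bounds: "0 < accept_cutoff M" "accept_cutoff M < 1"
  using positive by (simp_all add: accept_cutoff_def)

text \<open>Limited feasible recourse bounds type L's cost only at the top requirement; the positive
  derivative and the mean value theorem carry this bound to all lower requirements.\<close>

lemma cost_L_mono:
  assumes "r \<in> \<R>"
  shows "cost M L r \<le> cost M L (req_hi M)"
proof -
  obtain K' where K':
    "\<And>x. x \<in> \<R> \<Longrightarrow> (cost M L has_real_derivative K' x) (at x within \<R>) \<and> K' x > 0"
    using model unfolding screening_model_def by meson
  show ?thesis
  proof (cases "r = req_hi M")
    case False
    with assms have lt: "r < req_hi M"
      by (simp add: requirements_def)
    have sub: "{r..req_hi M} \<subseteq> \<R>"
      using assms by (auto simp: requirements_def)
    have "(cost M L has_derivative (*) (K' x)) (at x within {r..req_hi M})"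
      if "r \<le> x" "x \<le> req_hi M" for x
      using has_field_derivative_subset[OF _ sub, of _ _ x] K'[of x] sub that
      by (auto simp: has_field_derivative_def)
    then obtain x where x: "x \<in> {r<..<req_hi M}"
      "cost M L (req_hi M) - cost M L r = K' x * (req_hi M - r)"
      using mvt_simple[OF lt] by meson
    moreover have "K' x > 0"
      using K' subsetD[OF sub] x by simp
    ultimately have "cost M L (req_hi M) - cost M L r > 0"
      using lt by simp
    then show ?thesis
      by simp
  qed simp
qed

lemma cost_bounds:
  assumes "r \<in> \<R>"
  shows "0 \<le> cost M \<theta> r" "cost M \<theta> r < val M"
proof -
  show "0 \<le> cost M \<theta> r"
    using model assms unfolding screening_model_def by meson
  have "cost M L r < val M"
    using cost_L_mono[OF assms] limited by (simp add: limited_feasible_recourse_def)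
  moreover have "cost M H r \<le> cost M L r"
    using model assms by (simp add: screening_model_def)
  ultimately show "cost M \<theta> r < val M"
    by (cases \<theta>) auto
qed

text \<open>Costs stay strictly below \<open>val M\<close>, so the clipping at 0 never
  binds.\<close>

lemma completion_prob_bounds:
  assumes "r \<in> \<R>"
  shows "0 < q \<theta> r" "q \<theta> r \<le> 1" "q L r \<le> q H r"
proof -
  show "0 < q \<theta> r" "q \<theta> r \<le> 1"
    using cost_bounds[OF assms, of \<theta>] positive by (auto simp: completion_prob_def)
  have "(val M - cost M L r) / shock_max M \<le> (val M - cost M H r) / shock_max M"
    using model assms by (intro divide_right_mono) (auto simp: screening_model_def)
  then show "q L r \<le> q H r"
    unfolding completion_prob_def by (intro min.mono max.mono) auto
qed

lemma bonus_bounds: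
  assumes "r \<in> \<R>"
  shows "0 < bonus M * r" "bonus M * r < loss M"
proof -
  have "0 < r" "r \<le> req_hi M" "req_hi M < loss M / bonus M"
    using model limited assms
    by (auto simp: screening_model_def requirements_def limited_feasible_recourse_def)
  then show "0 < bonus M * r" "bonus M * r < loss M"
    using positive by (auto simp: field_simps intro: le_less_trans[of _ "bonus M * req_hi M"])
qed

section \<open>The offer payoff as an affine function of the belief\<close>

definition offer_gain_H :: "real \<Rightarrow> real" where
  "offer_gain_H r = q H r * (gain M + bonus M * r)"

text \<open>Minus the payoff from an offer to type L. With this sign it is positive, and the slope
  of the offer payoff in the belief is \<open>offer_gain_H r + offer_loss_L r\<close>.\<close>

definition offer_loss_L :: "real \<Rightarrow> real" where
  "offer_loss_L r = q L r * (loss M - bonus M * r)"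

lemma offer_payoff_affine:
  "offer_payoff M p r = p * offer_gain_H r - (1 - p) * offer_loss_L r"
  by (simp add: offer_payoff_def offer_gain_H_def offer_loss_L_def algebra_simps)

lemma offer_gain_H_bounds:
  assumes "r \<in> \<R>"
  shows "0 < offer_gain_H r" "offer_gain_H r \<le> gain M"
  using completion_prob_bounds[OF assms] bonus_bounds[OF assms] positive top assms
  by (auto simp: offer_gain_H_def acceptance_dominance_at_top_def add_pos_pos)

lemma offer_loss_L_bounds:
  assumes "r \<in> \<R>"
  shows "0 < offer_loss_L r" "offer_loss_L r < loss M"
proof -
  show "0 < offer_loss_L r"
    using completion_prob_bounds[OF assms] bonus_bounds[OF assms] by (simp add: offer_loss_L_def)
  have "offer_loss_L r \<le> 1 * (loss M - bonus M * r)"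
    unfolding offer_loss_L_def
    using completion_prob_bounds[OF assms] bonus_bounds[OF assms] by (intro mult_right_mono) auto
  with bonus_bounds[OF assms] show "offer_loss_L r < loss M"
    by simp
qed

section \<open>The value of recourse as a function of the belief\<close>

lemma offer_value_attainedE:
  obtains r where "r \<in> \<R>" "offer_value M p = offer_payoff M p r"
  using offer_value_attained[OF model, of p] by (auto simp: is_arg_max_def)

lemma offer_payoff_le_value:
  assumes "r \<in> \<R>"
  shows "offer_payoff M p r \<le> offer_value M p"
  using offer_value_attained[OF model, of p] assms by (auto simp: is_arg_max_def not_less)

lemma offer_payoff_diff:
  "offer_payoff M p' r - offer_payoff M p r = (p' - p) * (offer_gain_H r + offer_loss_L r)"
  by (simp add: offer_payoff_affine algebra_simps)

text \<open>The maximiser at the lower belief remains feasible at the higher one, where it already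
  pays more.\<close>

lemma offer_value_strict_mono:
  assumes "p < p'"
  shows "offer_value M p < offer_value M p'"
proof -
  obtain r where r: "r \<in> \<R>" "offer_value M p = offer_payoff M p r"
    by (rule offer_value_attainedE)
  have "0 < (p' - p) * (offer_gain_H r + offer_loss_L r)"
    using offer_gain_H_bounds[OF r(1)] offer_loss_L_bounds[OF r(1)] assms by simp
  then show ?thesis
    using r offer_payoff_diff[of p' r p] offer_payoff_le_value[OF r(1), of p'] by simp
qed

text \<open>Here the maximiser at the higher belief is tested at the lower one; its slope is below
  \<open>gain M + loss M\<close>, the slope of the acceptance payoff.\<close>

lemma offer_value_increment:
  assumes "p < p'"
  shows "offer_value M p' - offer_value M p < accept_payoff M p' - accept_payoff M p"
proof -
  obtain r where r: "r \<in> \<R>" "offer_value M p' = offer_payoff M p' r"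
    by (rule offer_value_attainedE)
  have "(p' - p) * (offer_gain_H r + offer_loss_L r) < (p' - p) * (gain M + loss M)"
    using offer_gain_H_bounds[OF r(1)] offer_loss_L_bounds[OF r(1)] assms
    by (intro mult_strict_left_mono) auto
  also have "\<dots> = accept_payoff M p' - accept_payoff M p"
    by (simp add: accept_payoff_def algebra_simps)
  finally show ?thesis
    using r offer_payoff_diff[of p' r p] offer_payoff_le_value[OF r(1), of p] by simp
qed

lemma continuous_on_accept_payoff: "continuous_on S (accept_payoff M)"
  unfolding accept_payoff_def by (intro continuous_intros)

text \<open>The two increment bounds make the value Lipschitz with the acceptance slope as
  constant.\<close>

lemma continuous_on_offer_value: "continuous_on S (offer_value M)"
proof -
  have ordered: "\<bar>offer_value M p' - offer_value M p\<bar> \<le> (gain M + loss M) * \<bar>p' - p\<bar>"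
    if "p < p'" for p p'
    using offer_value_increment[OF that] offer_value_strict_mono[OF that] that
    by (simp add: accept_payoff_def algebra_simps)
  have "(gain M + loss M)-lipschitz_on S (offer_value M)"
  proof (rule lipschitz_onI)
    fix p p'
    show "dist (offer_value M p) (offer_value M p') \<le> (gain M + loss M) * dist p p'"
      using ordered[of p p'] ordered[of p' p]
      by (cases p p' rule: linorder_cases) (auto simp: dist_real_def abs_minus_commute)
  qed (use positive in simp)
  then show ?thesis
    by (rule lipschitz_on_continuous_on)
qed

lemma accept_payoff_nonneg_iff: "accept_payoff M p \<ge> 0 \<longleftrightarrow> accept_cutoff M \<le> p"
  using positive by (simp add: accept_payoff_def accept_cutoff_def field_simps)

lemma accept_payoff_cutoff: "accept_payoff M (accept_cutoff M) = 0"
  using positive by (simp add: accept_payoff_def accept_cutoff_def field_simps)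

lemma offer_value_0: "offer_value M 0 < 0"
  by (rule offer_value_attainedE[of 0])
    (use offer_loss_L_bounds in \<open>simp add: offer_payoff_affine\<close>)

lemma offer_value_1: "offer_value M 1 \<le> accept_payoff M 1"
  by (rule offer_value_attainedE[of 1])
    (use offer_gain_H_bounds in \<open>simp add: offer_payoff_affine accept_payoff_def\<close>)

lemma offer_value_accept_cutoff: "offer_value M (accept_cutoff M) > 0"
proof -
  \<comment> \<open>Any feasible requirement will do; it need not be optimal at the cutoff.\<close>
  obtain r where r: "r \<in> \<R>"
    by (rule offer_value_attainedE)
  \<comment> \<open>The factor \<open>gain M + loss M\<close> clears the denominator of
    \<open>accept_cutoff M\<close>.\<close>
  have "(gain M + loss M) * offer_payoff M (accept_cutoff M) r =
      (gain M + loss M) * accept_cutoff M * (offer_gain_H r + offer_loss_L r)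
      - (gain M + loss M) * offer_loss_L r"
    by (simp add: offer_payoff_affine algebra_simps)
  also have "(gain M + loss M) * accept_cutoff M = loss M"
    using positive by (simp add: accept_cutoff_def)
  also have "loss M * (offer_gain_H r + offer_loss_L r) - (gain M + loss M) * offer_loss_L r =
      loss M * gain M * (q H r - q L r) + bonus M * r * (loss M * q H r + gain M * q L r)"
    by (simp add: offer_gain_H_def offer_loss_L_def algebra_simps)
  also have "\<dots> > 0"
    using completion_prob_bounds[OF r] bonus_bounds[OF r] positive
    by (intro add_nonneg_pos mult_nonneg_nonneg mult_pos_pos[of "bonus M * r"] add_pos_pos) auto
  finally have "offer_payoff M (accept_cutoff M) r > 0"
    using positive by (simp add: zero_less_mult_iff)
  then show ?thesis
    using offer_payoff_le_value[OF r] by (rule less_le_trans)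
qed

section \<open>Existence of the cutoffs\<close>

lemma threshold_cutoffs_exist:
  obtains pl ph where "threshold_cutoffs M pl ph"
proof -
  let ?pA = "accept_cutoff M"
  obtain pl where pl: "0 < pl" "pl \<le> ?pA" "offer_value M pl = 0"
    "\<And>p. offer_value M p \<ge> 0 \<longleftrightarrow> pl \<le> p"
    by (rule strict_increasing_crossing[OF accept_cutoff_bounds(1) continuous_on_offer_value
          offer_value_0 less_imp_le[OF offer_value_accept_cutoff] offer_value_strict_mono],
        assumption, rule that)
  then have "pl < ?pA"
    using offer_value_accept_cutoff by (cases "pl = ?pA") auto
  define advantage where "advantage p = accept_payoff M p - offer_value M p" for p
  have cont: "continuous_on {?pA..1} advantage"
    unfolding advantage_def
    by (intro continuous_on_diff continuous_on_accept_payoff continuous_on_offer_value)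
  have ends: "advantage ?pA < 0" "0 \<le> advantage 1"
    using offer_value_accept_cutoff accept_payoff_cutoff offer_value_1
    by (simp_all add: advantage_def)
  have mono: "advantage p < advantage p'" if "p < p'" for p p'
    using offer_value_increment[OF that] by (simp add: advantage_def)
  obtain ph where ph: "?pA < ph" "ph \<le> 1" "advantage ph = 0"
    "\<And>p. advantage p \<ge> 0 \<longleftrightarrow> ph \<le> p"
    by (rule strict_increasing_crossing[OF accept_cutoff_bounds(2) cont ends mono],
        assumption, rule that)
  \<comment> \<open>From \<open>ph\<close> on, acceptance beats recourse, and it beats rejection
    because \<open>ph\<close> exceeds the acceptance cutoff. The weak inequalities of the crossings
    match the tie-breaking, so each cutoff belongs to the region above it.\<close>
  have decision: "optimal_decision M p =
      (if ph \<le> p then Accept else if pl \<le> p then Recourse else Reject)" for p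
    using pl(4)[of p] ph(4)[of p] accept_payoff_nonneg_iff[of p] \<open>pl < ?pA\<close> ph(1)
    by (auto simp: optimal_decision_def advantage_def)
  have "threshold_cutoffs M pl ph"
    using pl(1) \<open>pl < ?pA\<close> ph(1,2) by (auto simp: threshold_cutoffs_def decision)
  then show thesis
    by (rule that)
qed

section \<open>Applicant welfare under recourse\<close>

text \<open>The cost may be zero, so strictness below \<open>val M\<close> comes from the
  shock.\<close>

lemma type_recourse_benefit_bounds:
  assumes "r \<in> \<R>"
  shows "0 < type_recourse_benefit M \<theta> r" "type_recourse_benefit M \<theta> r < val M"
  using uniform_expected_excess_bounds[of "val M - cost M \<theta> r" "shock_max M"]
    cost_bounds[OF assms, of \<theta>] positive
  by (auto simp: type_recourse_benefit_def)

lemma recourse_benefit_bounds: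
  assumes "r \<in> \<R>" "0 < p" "p \<le> 1"
  shows "0 < recourse_benefit M p r" "recourse_benefit M p r < val M"
proof -
  note B = type_recourse_benefit_bounds[OF assms(1)]
  show "0 < recourse_benefit M p r"
    using B(1)[of H] B(1)[of L] assms
    by (auto simp: recourse_benefit_def intro!: add_pos_nonneg)
  \<comment> \<open>Strictness is taken from the H term, since the weight \<open>1 - p\<close>
    vanishes at \<open>p = 1\<close>.\<close>
  have "recourse_benefit M p r < p * val M + (1 - p) * val M"
    unfolding recourse_benefit_def using B(2)[of H] B(2)[of L] assms
    by (intro add_less_le_mono mult_left_mono mult_strict_left_mono) auto
  then show "recourse_benefit M p r < val M"
    by (simp add: algebra_simps)
qed

end

section \<open>Uniqueness of the cutoffs and the welfare comparison\<close>

text \<open>The recourse region is a nonempty half-open interval, which determines both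
  endpoints.\<close>

lemma threshold_cutoffs_unique:
  assumes "threshold_cutoffs M pl ph" "threshold_cutoffs M pl' ph'"
  shows "pl = pl'" "ph = ph'"
proof -
  have "{pl..<ph} = {pl'..<ph'}" "pl < ph" "pl' < ph'"
    using assms by (auto simp: threshold_cutoffs_def)
  then show "pl = pl'" "ph = ph'"
    by (simp_all add: atLeastLessThan_eq_iff)
qed

lemma threshold_cutoffs_decision:
  assumes "threshold_cutoffs M pl ph" "p \<in> {0..1}"
  shows "optimal_decision M p =
    (if p < pl then Reject else if p < ph then Recourse else Accept)"
proof -
  have "optimal_decision M p = Reject \<longleftrightarrow> p \<in> {0..<pl}"
    "optimal_decision M p = Recourse \<longleftrightarrow> p \<in> {pl..<ph}"
    "optimal_decision M p = Accept \<longleftrightarrow> p \<in> {ph..1}"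
    using assms unfolding threshold_cutoffs_def by blast+
  with assms(2) show ?thesis
    by auto
qed

theorem proposition4:
  fixes M :: screening and rs :: "real \<Rightarrow> real"
  assumes "screening_model M"
    and "limited_feasible_recourse M"
    and "acceptance_dominance_at_top M"
    and "optimal_requirement M rs"
  shows "(\<exists>!c. threshold_cutoffs M (fst c) (snd c)) \<and>
    (\<forall>pl ph. threshold_cutoffs M pl ph \<longrightarrow>
      (\<forall>p\<in>{0..<pl} \<union> {ph..1}. recourse_welfare M rs p = benchmark_welfare M p) \<and>
      (\<forall>p\<in>{pl..<accept_cutoff M}.
         recourse_welfare M rs p > benchmark_welfare M p \<and> benchmark_welfare M p = 0) \<and>
      (\<forall>p\<in>{accept_cutoff M..<ph}.
         recourse_welfare M rs p < benchmark_welfare M p \<and> benchmark_welfare M p = val M))"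
proof (intro conjI allI impI)
  interpret screening_setting M
    by unfold_locales (fact assms)+
  show "\<exists>!c. threshold_cutoffs M (fst c) (snd c)"
  proof -
    obtain pl ph where "threshold_cutoffs M pl ph"
      by (rule threshold_cutoffs_exist)
    then show ?thesis
      by (intro ex1I[of _ "(pl, ph)"]) (auto simp: prod_eq_iff dest: threshold_cutoffs_unique)
  qed
  fix pl ph
  assume cutoffs: "threshold_cutoffs M pl ph"
  then have order: "0 < pl" "pl < accept_cutoff M" "accept_cutoff M < ph" "ph \<le> 1"
    by (auto simp: threshold_cutoffs_def)
  note decision = threshold_cutoffs_decision[OF cutoffs]
  \<comment> \<open>The acceptance cutoff lies strictly between \<open>pl\<close> and
    \<open>ph\<close>, so outside the recourse region the rule decides as the benchmark
    does.\<close>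
  show "\<forall>p\<in>{0..<pl} \<union> {ph..1}. recourse_welfare M rs p = benchmark_welfare M p"
    using order by (auto simp: recourse_welfare_def benchmark_welfare_def decision)
  \<comment> \<open>One estimate serves both sides: the lower bound gives the gain where the
    benchmark rejects, the upper bound the loss where it accepts.\<close>
  have welfare: "0 < recourse_welfare M rs p \<and> recourse_welfare M rs p < val M"
    if "p \<in> {pl..<ph}" for p
  proof -
    have p: "p \<in> {0..1}" "0 < p" "p \<le> 1" and "optimal_decision M p = Recourse"
      using that order decision[of p] by auto
    moreover from this have "rs p \<in> \<R>"
      using assms(4) by (auto simp: optimal_requirement_def is_arg_max_def)
    ultimately show ?thesis
      using recourse_benefit_bounds[of "rs p" p] by (simp add: recourse_welfare_def)
  qed
  show "\<forall>p\<in>{pl..<accept_cutoff M}.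
      recourse_welfare M rs p > benchmark_welfare M p \<and> benchmark_welfare M p = 0"
    using order welfare by (auto simp: benchmark_welfare_def)
  show "\<forall>p\<in>{accept_cutoff M..<ph}.
      recourse_welfare M rs p < benchmark_welfare M p \<and> benchmark_welfare M p = val M"
    using order welfare by (auto simp: benchmark_welfare_def)
qed

end
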